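(* Let $p,K\ge 1$ be integers, let $\boldsymbol S\in\mathbb C^{p\times p}$ be a covariance matrix (Hermitian positive semidefinite), and let $\boldsymbol J_0,\ldots,\boldsymbol J_{K-1}$ be independent and identically distributed random vectors, each distributed as $\mathcal N_p^C\{\boldsymbol 0,\boldsymbol S\}$. Put $\hat{\boldsymbol S}=\frac1K\sum_{k=0}^{K-1}\boldsymbol J_k\boldsymbol J_k^H$, $\boldsymbol T=(\mathrm{tr}\{\boldsymbol S\}/p)\boldsymbol I_p$, $\beta^2=E\{\|\hat{\boldsymbol S}-\boldsymbol S\|_{\rm F}^2\}$ and $\delta^2=E\{\|\hat{\boldsymbol S}-\boldsymbol T\|_{\rm F}^2\}$. Then $\rho_0=\beta^2/\delta^2$ can be written $$\rho_0=\frac{\mathrm{tr}^2\{\boldsymbol S\}}{\left[1-\frac Kp\right]\mathrm{tr}^2\{\boldsymbol S\}+K\,\mathrm{tr}\{\boldsymbol S^2\}}.$$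
   Context: $\mathcal N_p^C\{\boldsymbol 0,\boldsymbol S\}$ denotes the zero-mean circularly-symmetric $p$-variate complex Gaussian distribution with covariance matrix $E\{\boldsymbol J\boldsymbol J^H\}=\boldsymbol S$ (and $E\{\boldsymbol J\boldsymbol J^T\}=\boldsymbol 0$). $^H$ is conjugate transpose, $\mathrm{tr}$ is the trace, $\mathrm{tr}^2\{\boldsymbol A\}=(\mathrm{tr}\{\boldsymbol A\})^2$, $\|\boldsymbol A\|_{\rm F}=[\mathrm{tr}\{\boldsymbol A\boldsymbol A^H\}]^{1/2}$ is the Frobenius norm, and $\boldsymbol I_p$ is the $p\times p$ identity matrix. The ratio $\rho_0$ is considered whenever $\delta^2\neq0$ (equivalently $\boldsymbol S\ne\boldsymbol 0$). *)

theory Defs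
  imports "HOL-Probability.Probability"
begin

definition conj_transpose :: "complex^'n^'m \<Rightarrow> complex^'m^'n" where
  "conj_transpose A = (\<chi> i j. cnj (A $ j $ i))"

definition frobenius_norm :: "complex^'n^'n \<Rightarrow> real" where
  "frobenius_norm A = sqrt (Re (trace (A ** conj_transpose A)))"

text \<open>For a Hermitian matrix the quadratic form below is automatically real, so that taking
  its real part loses nothing.\<close>

definition hermitian_psd :: "complex^'n^'n \<Rightarrow> bool" where
  "hermitian_psd A \<longleftrightarrow> conj_transpose A = A \<and>
     (\<forall>x :: complex^'n. 0 \<le> Re (\<Sum>i\<in>UNIV. cnj (x $ i) * (A *v x) $ i))"

text \<open>The column-times-row products $x y^H$ and $x y^T$.\<close>

definition outer_H :: "complex^'n \<Rightarrow> complex^'n \<Rightarrow> complex^'n^'n" where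
  "outer_H x y = (\<chi> i j. x $ i * cnj (y $ j))"

definition outer_T :: "complex^'n \<Rightarrow> complex^'n \<Rightarrow> complex^'n^'n" where
  "outer_T x y = (\<chi> i j. x $ i * y $ j)"

text \<open>Univariate normal laws; point masses count as normal laws of variance zero, which is
  needed to allow singular covariance matrices.\<close>

definition normal_law :: "real measure \<Rightarrow> bool" where
  "normal_law N \<longleftrightarrow> (\<exists>m. N = return borel m \<or> (\<exists>\<sigma>>0. N = density lborel (normal_density m \<sigma>)))"

text \<open>A complex random vector is Gaussian if its real and imaginary parts are jointly Gaussian,
  that is, if every real-linear functional of it is normal (\<open>linear\<close> is linearity over the reals).
  The moments then exist, and the law is determined by the mean, the covariance matrix and the
  pseudo-covariance matrix; the latter vanishes in the circularly-symmetric case.\<close>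

definition circ_complex_gaussian :: "complex^'n^'n \<Rightarrow> (complex^'n) measure \<Rightarrow> bool" where
  "circ_complex_gaussian S \<mu> \<longleftrightarrow>
     prob_space \<mu> \<and> sets \<mu> = sets borel \<and>
     (\<forall>f :: complex^'n \<Rightarrow> real. linear f \<longrightarrow> normal_law (distr \<mu> borel f)) \<and>
     (\<integral>x. x \<partial>\<mu>) = 0 \<and>
     (\<integral>x. outer_H x x \<partial>\<mu>) = S \<and>
     (\<integral>x. outer_T x x \<partial>\<mu>) = 0"

definition sample_cov :: "nat \<Rightarrow> (nat \<Rightarrow> 'w \<Rightarrow> complex^'n) \<Rightarrow> 'w \<Rightarrow> complex^'n^'n" where
  "sample_cov K J \<omega> = (1 / real K) *\<^sub>R (\<Sum>k<K. outer_H (J k \<omega>) (J k \<omega>))"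

text \<open>\<open>mat c\<close> is the scalar matrix $c I$.\<close>

definition target_mat :: "complex^'n^'n \<Rightarrow> complex^'n^'n" where
  "target_mat S = mat (trace S / of_nat CARD('n))"

definition beta_sq :: "'w measure \<Rightarrow> nat \<Rightarrow> (nat \<Rightarrow> 'w \<Rightarrow> complex^'n) \<Rightarrow> complex^'n^'n \<Rightarrow> real" where
  "beta_sq M K J S = (\<integral>\<omega>. (frobenius_norm (sample_cov K J \<omega> - S))\<^sup>2 \<partial>M)"

definition delta_sq :: "'w measure \<Rightarrow> nat \<Rightarrow> (nat \<Rightarrow> 'w \<Rightarrow> complex^'n) \<Rightarrow> complex^'n^'n \<Rightarrow> real" where
  "delta_sq M K J S = (\<integral>\<omega>. (frobenius_norm (sample_cov K J \<omega> - target_mat S))\<^sup>2 \<partial>M)"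

end

theory Submission
  imports Defs
begin

text \<open>Polarizing the univariate identity $E X^4 = 3 (E X^2)^2$ gives Isserlis' formula
  $E[X^2 Y^2] = E[X^2] E[Y^2] + 2 (E[XY])^2$ for jointly normal centred $X$, $Y$. Summing it over the
  real and imaginary parts of the coordinates, circular symmetry yields
  $E \|J J^H\|^2 = \mathrm{tr}^2 S + \|S\|^2$, so each $J_k J_k^H$ has total variance
  $\mathrm{tr}^2 S$. By independence $\beta^2 = \mathrm{tr}^2 S / K$, and the bias-variance
  decomposition gives $\delta^2 = \beta^2 + \|S - T\|^2 = \beta^2 + \mathrm{tr}\, S^2 - \mathrm{tr}^2 S / p$.\<close>

section \<open>Moments of normal laws and Isserlis' formula\<close>

lemma integrable_normal_law_power:
  assumes "normal_law N"
  shows "integrable N (\<lambda>x. x ^ k)"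
proof -
  from assms consider (point) m where "N = return borel m"
    | (dens) m \<sigma> where "\<sigma> > 0" "N = density lborel (normal_density m \<sigma>)"
    unfolding normal_law_def by blast
  then show ?thesis
  proof cases
    case point
    then interpret prob_space N by (simp add: prob_space_return)
    have "AE x in N. x = m"
      unfolding point by (simp add: AE_return)
    then have "AE x in N. norm (x ^ k) \<le> \<bar>m ^ k\<bar>"
      by eventually_elim simp
    then show ?thesis
      by (rule integrable_const_bound) (simp add: point)
  next
    case dens
    \<comment> \<open>All central moments of the density exist; expanding
      \<open>((x - m) + m) ^ k\<close> binomially writes the raw moment as a finite combination of
      them.\<close>
    have "integrable lborel (\<lambda>x. \<Sum>j\<le>k. of_nat (k choose j) * m ^ (k - j) *
        (normal_density m \<sigma> x * (x - m) ^ j))"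
      by (intro Bochner_Integration.integrable_sum integrable_mult_right
          integrable_normal_moment[OF dens(1)])
    moreover have "(\<Sum>j\<le>k. of_nat (k choose j) * m ^ (k - j) *
        (normal_density m \<sigma> x * (x - m) ^ j)) = normal_density m \<sigma> x *\<^sub>R x ^ k" for x
      using binomial_ring[of "x - m" m k]
      by (simp add: sum_distrib_left mult_ac)
    ultimately show ?thesis
      unfolding dens(2) by (subst integrable_density) (auto simp: normal_density_nonneg)
  qed
qed

lemma normal_law_fourth_moment:
  assumes "normal_law N" and mean: "(\<integral>x. x \<partial>N) = 0"
  shows "(\<integral>x. x ^ 4 \<partial>N) = 3 * (\<integral>x. x\<^sup>2 \<partial>N)\<^sup>2"
proof -
  from assms(1) consider (point) m where "N = return borel m"
    | (dens) m \<sigma> where "\<sigma> > 0" "N = density lborel (normal_density m \<sigma>)"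
    unfolding normal_law_def by blast
  then show ?thesis
  proof cases
    case point
    have "m = 0"
      using mean unfolding point by (simp add: integral_return)
    then show ?thesis
      unfolding point by (simp add: integral_return)
  next
    case dens
    have eq: "(\<integral>x. f x \<partial>N) = (\<integral>x. normal_density m \<sigma> x * f x \<partial>lborel)"
      if "f \<in> borel_measurable borel" for f :: "real \<Rightarrow> real"
      unfolding dens(2) using that
      by (subst integral_density) (auto simp: normal_density_nonneg)
    have m: "m = 0"
      using mean integral_normal_moment_nz_1[OF dens(1), of m] by (simp add: eq)
    \<comment> \<open>The even moment of order 2j is (2j)! / ((2 / sigma^2)^j j!); j = 2 gives 24 /
      (8 / sigma^4) = 3 sigma^4, and j = 1 below gives sigma^2.\<close>
    have "(\<integral>x. x ^ 4 \<partial>N) = 3 * \<sigma> ^ 4"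
      using integral_normal_moment_even[OF dens(1), of m 2]
      by (simp add: eq m fact_numeral power_divide field_simps)
    moreover have "(\<integral>x. x\<^sup>2 \<partial>N) = \<sigma>\<^sup>2"
      using integral_normal_moment_even[OF dens(1), of m 1]
      by (simp add: eq m fact_numeral power2_eq_square field_simps)
    ultimately show ?thesis
      by simp
  qed
qed

text \<open>Joint normality is expressed in Cramer-Wold form, by normality of all combinations a X +
  b Y. No joint density is involved, so degenerate pairs such as X = Y or X = 0 are covered.\<close>

lemma
  fixes X Y :: "'a \<Rightarrow> real"
  assumes X[measurable]: "X \<in> borel_measurable M" and Y[measurable]: "Y \<in> borel_measurable M"
    and normal: "\<And>a b. normal_law (distr M borel (\<lambda>x. a * X x + b * Y x))"
    and mean: "(\<integral>x. X x \<partial>M) = 0" "(\<integral>x. Y x \<partial>M) = 0"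
  shows integrable_joint_normal_mult: "integrable M (\<lambda>x. X x * Y x)"
    and integrable_joint_normal_sq_mult_sq: "integrable M (\<lambda>x. (X x)\<^sup>2 * (Y x)\<^sup>2)"
    and integral_joint_normal_sq_mult_sq: "(\<integral>x. (X x)\<^sup>2 * (Y x)\<^sup>2 \<partial>M) =
      (\<integral>x. (X x)\<^sup>2 \<partial>M) * (\<integral>x. (Y x)\<^sup>2 \<partial>M) + 2 * (\<integral>x. X x * Y x \<partial>M)\<^sup>2"
proof -
  have int: "integrable M (\<lambda>x. (a * X x + b * Y x) ^ k)" for a b k
    using integrable_normal_law_power[OF normal, of a b k] by (simp add: integrable_distr_eq)
  have intX: "integrable M (\<lambda>x. X x ^ k)" and intY: "integrable M (\<lambda>x. Y x ^ k)" for k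
    using int[of 1 0 k] int[of 0 1 k] by simp_all
  have four: "(\<integral>x. (a * X x + b * Y x) ^ 4 \<partial>M) = 3 * (\<integral>x. (a * X x + b * Y x)\<^sup>2 \<partial>M)\<^sup>2" for a b
  proof -
    have "(\<integral>x. x \<partial>distr M borel (\<lambda>x. a * X x + b * Y x)) = 0"
      using intX[of 1] intY[of 1] mean by (simp add: integral_distr)
    from normal_law_fourth_moment[OF normal this] show ?thesis
      by (simp add: integral_distr)
  qed
  \<comment> \<open>The coefficients 1 and -1 stay explicit here and in \<open>XXYY\<close> so that
    the terms match the pattern of \<open>int\<close>, \<open>four\<close> and
    \<open>var\<close>.\<close>
  have XY: "X x * Y x = ((1 * X x + 1 * Y x)\<^sup>2 - (X x)\<^sup>2 - (Y x)\<^sup>2) / 2" for x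
    by (simp add: power2_eq_square algebra_simps)
  show iXY: "integrable M (\<lambda>x. X x * Y x)"
    unfolding XY by (intro integrable_divide_zero Bochner_Integration.integrable_diff int intX intY)
  \<comment> \<open>Odd powers cancel in (X + Y)^4 + (X - Y)^4 = 2 X^4 + 12 X^2 Y^2 + 2 Y^4, which
    leaves X^2 Y^2 as a combination of fourth powers of normal variables.\<close>
  have XXYY: "(X x)\<^sup>2 * (Y x)\<^sup>2 = ((1 * X x + 1 * Y x) ^ 4 + (1 * X x + (-1) * Y x) ^ 4
      - 2 * X x ^ 4 - 2 * Y x ^ 4) / 12" for x
    by (simp add: power2_eq_square power4_eq_xxxx algebra_simps)
  show "integrable M (\<lambda>x. (X x)\<^sup>2 * (Y x)\<^sup>2)"
    unfolding XXYY
    by (intro integrable_divide_zero Bochner_Integration.integrable_diff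
        Bochner_Integration.integrable_add integrable_mult_right int intX intY)
  define V W C where "V = (\<integral>x. (X x)\<^sup>2 \<partial>M)" and "W = (\<integral>x. (Y x)\<^sup>2 \<partial>M)"
    and "C = (\<integral>x. X x * Y x \<partial>M)"
  have var: "(\<integral>x. (a * X x + b * Y x)\<^sup>2 \<partial>M) = a\<^sup>2 * V + b\<^sup>2 * W + 2 * a * b * C" for a b
  proof -
    have "(\<integral>x. (a * X x + b * Y x)\<^sup>2 \<partial>M) =
        (\<integral>x. a\<^sup>2 * (X x)\<^sup>2 + b\<^sup>2 * (Y x)\<^sup>2 + 2 * a * b * (X x * Y x) \<partial>M)"
      by (rule Bochner_Integration.integral_cong) (auto simp: power2_eq_square algebra_simps)
    also have "\<dots> = a\<^sup>2 * V + b\<^sup>2 * W + 2 * a * b * C"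
      unfolding V_def W_def C_def
      using iXY intX[of 2] intY[of 2] by simp
    finally show ?thesis .
  qed
  have "(\<integral>x. (X x)\<^sup>2 * (Y x)\<^sup>2 \<partial>M) =
    ((\<integral>x. (1 * X x + 1 * Y x) ^ 4 \<partial>M) + (\<integral>x. (1 * X x + (-1) * Y x) ^ 4 \<partial>M)
      - 2 * (\<integral>x. X x ^ 4 \<partial>M) - 2 * (\<integral>x. Y x ^ 4 \<partial>M)) / 12"
    unfolding XXYY
    using int[of 1 1 4] int[of 1 "-1" 4] intX[of 4] intY[of 4] by simp
  \<comment> \<open>The variances of X + Y and X - Y are V + W + 2 C and V + W - 2 C;
    \<open>four\<close> replaces each fourth moment by three times the squared variance.\<close>
  also have "\<dots> = (3 * (V + W + 2 * C)\<^sup>2 + 3 * (V + W - 2 * C)\<^sup>2 - 6 * V\<^sup>2 - 6 * W\<^sup>2) / 12"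
    unfolding four var using four[of 1 0] four[of 0 1] by (simp add: V_def W_def)
  also have "\<dots> = V * W + 2 * C\<^sup>2"
    by (simp add: power2_eq_square algebra_simps)
  finally show "(\<integral>x. (X x)\<^sup>2 * (Y x)\<^sup>2 \<partial>M) =
      (\<integral>x. (X x)\<^sup>2 \<partial>M) * (\<integral>x. (Y x)\<^sup>2 \<partial>M) + 2 * (\<integral>x. X x * Y x \<partial>M)\<^sup>2"
    unfolding V_def W_def C_def .
qed

section \<open>Vector-valued expectations and independence\<close>

lemma integrable_euclideanI:
  fixes f :: "'a \<Rightarrow> 'b::euclidean_space"
  assumes "\<And>b. b \<in> Basis \<Longrightarrow> integrable M (\<lambda>x. f x \<bullet> b)"
  shows "integrable M f"
proof -
  have "integrable M (\<lambda>x. \<Sum>b\<in>Basis. (f x \<bullet> b) *\<^sub>R b)"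
    using assms by (intro Bochner_Integration.integrable_sum integrable_scaleR_left) auto
  then show ?thesis by (simp add: euclidean_representation)
qed

lemma integrable_vecI:
  fixes f :: "'a \<Rightarrow> 'b::euclidean_space ^ 'n"
  assumes "\<And>i. integrable M (\<lambda>x. f x $ i)"
  shows "integrable M f"
proof (rule integrable_euclideanI)
  fix b :: "'b ^ 'n" assume "b \<in> Basis"
  then obtain i u where b: "b = axis i u"
    by (auto simp: Basis_vec_def)
  show "integrable M (\<lambda>x. f x \<bullet> b)"
    unfolding b inner_axis by (intro integrable_inner_left assms)
qed

lemma integral_vec_nth:
  fixes f :: "'a \<Rightarrow> 'b::euclidean_space ^ 'n"
  assumes "integrable M f"
  shows "integral\<^sup>L M f $ i = (\<integral>x. f x $ i \<partial>M)"
  by (rule integral_bounded_linear[OF bounded_linear_vec_nth assms, symmetric])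

text \<open>Expanding the inner product over \<open>Basis\<close> reduces both claims to products of
  independent real variables.\<close>

lemma (in prob_space)
  fixes X Y :: "'a \<Rightarrow> 'b::euclidean_space"
  assumes indep: "indep_var borel X borel Y" and int: "integrable M X" "integrable M Y"
  shows expectation_inner_indep_var: "expectation (\<lambda>\<omega>. X \<omega> \<bullet> Y \<omega>) = expectation X \<bullet> expectation Y"
    and integrable_inner_indep_var: "integrable M (\<lambda>\<omega>. X \<omega> \<bullet> Y \<omega>)"
proof -
  have ind: "indep_var borel (\<lambda>\<omega>. X \<omega> \<bullet> b) borel (\<lambda>\<omega>. Y \<omega> \<bullet> b)" for b
    using indep_var_compose[OF indep, of "\<lambda>x. x \<bullet> b" borel "\<lambda>x. x \<bullet> b" borel]
    by (simp add: comp_def)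
  have int': "integrable M (\<lambda>\<omega>. (X \<omega> \<bullet> b) * (Y \<omega> \<bullet> b))" for b
    using int by (intro indep_var_integrable ind) auto
  have eq: "(\<lambda>\<omega>. X \<omega> \<bullet> Y \<omega>) = (\<lambda>\<omega>. \<Sum>b\<in>Basis. (X \<omega> \<bullet> b) * (Y \<omega> \<bullet> b))"
    by (rule ext) (rule euclidean_inner)
  show "integrable M (\<lambda>\<omega>. X \<omega> \<bullet> Y \<omega>)"
    unfolding eq using int' by auto
  show "expectation (\<lambda>\<omega>. X \<omega> \<bullet> Y \<omega>) = expectation X \<bullet> expectation Y"
    unfolding eq euclidean_inner[of "expectation X" "expectation Y"]
    using int int' by (simp add: indep_var_lebesgue_integral[OF ind])
qed

text \<open>Serves two purposes: with \<open>c\<close> the mean of \<open>X\<close> it yields the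
  total variance, and with \<open>X\<close> centred the cross term vanishes, which gives the
  bias-variance decomposition.\<close>

lemma (in prob_space)
  fixes X :: "'a \<Rightarrow> 'b::euclidean_space"
  assumes int: "integrable M X" "integrable M (\<lambda>\<omega>. (norm (X \<omega>))\<^sup>2)"
  shows expectation_norm_diff_sq: "expectation (\<lambda>\<omega>. (norm (X \<omega> - c))\<^sup>2) =
      expectation (\<lambda>\<omega>. (norm (X \<omega>))\<^sup>2) - 2 * (expectation X \<bullet> c) + (norm c)\<^sup>2"
    and integrable_norm_diff_sq: "integrable M (\<lambda>\<omega>. (norm (X \<omega> - c))\<^sup>2)"
proof -
  have eq: "(norm (X \<omega> - c))\<^sup>2 = (norm (X \<omega>))\<^sup>2 - 2 * (X \<omega> \<bullet> c) + (norm c)\<^sup>2" for \<omega>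
    by (simp add: power2_norm_eq_inner inner_diff inner_commute)
  show "integrable M (\<lambda>\<omega>. (norm (X \<omega> - c))\<^sup>2)"
    unfolding eq using int by simp
  show "expectation (\<lambda>\<omega>. (norm (X \<omega> - c))\<^sup>2) =
      expectation (\<lambda>\<omega>. (norm (X \<omega>))\<^sup>2) - 2 * (expectation X \<bullet> c) + (norm c)\<^sup>2"
    unfolding eq using int by (simp add: prob_space)
qed

text \<open>Pythagoras in L^2: distinct centred independent vectors are orthogonal, so only the
  diagonal of the expanded double sum survives.\<close>

lemma (in prob_space)
  fixes X :: "'i \<Rightarrow> 'a \<Rightarrow> 'b::euclidean_space"
  assumes fin: "finite I" and indep: "indep_vars (\<lambda>_. borel) X I"
    and int: "\<And>i. i \<in> I \<Longrightarrow> integrable M (X i)"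
    and int2: "\<And>i. i \<in> I \<Longrightarrow> integrable M (\<lambda>\<omega>. (norm (X i \<omega>))\<^sup>2)"
    and mean: "\<And>i. i \<in> I \<Longrightarrow> expectation (X i) = 0"
  shows expectation_norm_sum_sq_indep: "expectation (\<lambda>\<omega>. (norm (\<Sum>i\<in>I. X i \<omega>))\<^sup>2) =
      (\<Sum>i\<in>I. expectation (\<lambda>\<omega>. (norm (X i \<omega>))\<^sup>2))"
    and integrable_norm_sum_sq_indep: "integrable M (\<lambda>\<omega>. (norm (\<Sum>i\<in>I. X i \<omega>))\<^sup>2)"
proof -
  have eq: "(norm (\<Sum>i\<in>I. X i \<omega>))\<^sup>2 = (\<Sum>i\<in>I. \<Sum>j\<in>I. X i \<omega> \<bullet> X j \<omega>)" for \<omega>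
    unfolding power2_norm_eq_inner inner_sum_left inner_sum_right by (rule sum.swap)
  have ind: "indep_var borel (X i) borel (X j)" if "i \<in> I" "j \<in> I" "i \<noteq> j" for i j
  proof -
    \<comment> \<open>Disjoint subfamilies of an independent family are independent. The singletons
      \<open>{i}\<close> and \<open>{j}\<close> give this for product-valued variables, and
      projecting to the single coordinate recovers \<open>X i\<close> and
      \<open>X j\<close>.\<close>
    have "indep_var (Pi\<^sub>M {i} (\<lambda>_. borel)) (\<lambda>\<omega>. restrict (\<lambda>i. X i \<omega>) {i})
        (Pi\<^sub>M {j} (\<lambda>_. borel)) (\<lambda>\<omega>. restrict (\<lambda>i. X i \<omega>) {j})"
      using that by (intro indep_var_restrict[OF indep]) auto
    then have "indep_var borel ((\<lambda>f. f i) \<circ> (\<lambda>\<omega>. restrict (\<lambda>i. X i \<omega>) {i}))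
        borel ((\<lambda>f. f j) \<circ> (\<lambda>\<omega>. restrict (\<lambda>i. X i \<omega>) {j}))"
      by (rule indep_var_compose) (rule measurable_component_singleton, simp)+
    then show ?thesis by (simp add: comp_def)
  qed
  have I: "integrable M (\<lambda>\<omega>. X i \<omega> \<bullet> X j \<omega>)" if "i \<in> I" "j \<in> I" for i j
    using that integrable_inner_indep_var[OF ind int int] int2[of i]
    by (cases "i = j") (auto simp: power2_norm_eq_inner)
  then show "integrable M (\<lambda>\<omega>. (norm (\<Sum>i\<in>I. X i \<omega>))\<^sup>2)"
    unfolding eq by auto
  have E: "expectation (\<lambda>\<omega>. X i \<omega> \<bullet> X j \<omega>) =
      (if i = j then expectation (\<lambda>\<omega>. (norm (X i \<omega>))\<^sup>2) else 0)" if "i \<in> I" "j \<in> I" for i j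
    using that expectation_inner_indep_var[OF ind int int] mean
    by (auto simp: power2_norm_eq_inner)
  show "expectation (\<lambda>\<omega>. (norm (\<Sum>i\<in>I. X i \<omega>))\<^sup>2) =
      (\<Sum>i\<in>I. expectation (\<lambda>\<omega>. (norm (X i \<omega>))\<^sup>2))"
    unfolding eq using I E fin by simp
qed

section \<open>Trace, Frobenius norm and scalar matrices\<close>

lemma trace_mult_conj_transpose: "trace (A ** conj_transpose A) = of_real ((norm A)\<^sup>2)"
  by (simp add: complex_eq_iff trace_def matrix_matrix_mult_def conj_transpose_def
      power2_norm_eq_inner inner_vec_def inner_complex_def)

text \<open>Makes the preceding results on \<open>norm\<close> and the real inner product of
  Euclidean spaces applicable to matrices.\<close>

lemma frobenius_norm_eq_norm: "frobenius_norm A = norm A"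
  by (simp add: frobenius_norm_def trace_mult_conj_transpose)

lemma hermitian_trace_real:
  assumes "conj_transpose S = S"
  shows "trace S = of_real (Re (trace S))"
proof -
  have "cnj (S $ i $ i) = S $ i $ i" for i
    using assms by (metis (no_types, lifting) conj_transpose_def vec_lambda_beta)
  then have "cnj (trace S) = trace S"
    by (simp add: trace_def)
  then show ?thesis
    by (simp add: complex_eq_iff)
qed

lemma norm_outer_H_sq: "(norm (outer_H x y))\<^sup>2 = (norm x)\<^sup>2 * (norm y)\<^sup>2"
proof -
  have "(norm (outer_H x y))\<^sup>2 = (\<Sum>i\<in>UNIV. \<Sum>j\<in>UNIV. (norm (x $ i))\<^sup>2 * (norm (y $ j))\<^sup>2)"
    by (simp add: power2_norm_eq_inner inner_vec_def outer_H_def flip: power_mult_distrib)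
      (simp add: inner_complex_def algebra_simps)
  also have "\<dots> = (norm x)\<^sup>2 * (norm y)\<^sup>2"
    by (simp add: power2_norm_eq_inner inner_vec_def sum_product)
  finally show ?thesis .
qed

text \<open>\<open>target_mat S\<close> is the orthogonal projection of \<open>S\<close> onto the
  scalar matrices, so Pythagoras applies, the projection having squared norm |tr S|^2 / p.\<close>

lemma norm_diff_target_mat_sq:
  fixes S :: "complex^'n^'n"
  shows "(norm (S - target_mat S))\<^sup>2 = (norm S)\<^sup>2 - (norm (trace S))\<^sup>2 / CARD('n)"
proof -
  define c where "c = trace S / of_nat CARD('n)"
  have mat_inner: "A \<bullet> mat c = trace A \<bullet> c" for A :: "complex^'n^'n"
  proof -
    have "A \<bullet> mat c = (\<Sum>i\<in>UNIV. \<Sum>j\<in>UNIV. if i = j then A $ i $ j \<bullet> c else 0)"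
      unfolding inner_vec_def mat_def by (intro sum.cong refl) simp
    then show ?thesis
      by (simp add: trace_def inner_sum_left)
  qed
  \<comment> \<open>Equality of the traces makes the inner product of \<open>mat c\<close> with
    itself equal to that of \<open>S\<close> with \<open>mat c\<close>.\<close>
  have "trace (mat c :: complex^'n^'n) = trace S"
    by (simp add: trace_def mat_def c_def)
  moreover have "trace S \<bullet> c = (norm (trace S))\<^sup>2 / CARD('n)"
    by (simp add: c_def power2_norm_eq_inner inner_complex_def Re_divide_of_nat Im_divide_of_nat
        add_divide_distrib)
  ultimately show ?thesis
    unfolding target_mat_def c_def[symmetric]
    by (simp add: power2_norm_eq_inner inner_diff mat_inner inner_commute[of "mat c" S] trace_sub)
qed

section \<open>Second and fourth moments of circular Gaussian vectors\<close>

lemma circ_complex_gaussian_linear: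
  fixes f g :: "complex^'n \<Rightarrow> real"
  assumes gauss: "circ_complex_gaussian S \<mu>" and lin: "linear f" "linear g"
  shows "integrable \<mu> (\<lambda>x. f x * g x)"
    and "integrable \<mu> (\<lambda>x. (f x)\<^sup>2 * (g x)\<^sup>2)"
    and "(\<integral>x. (f x)\<^sup>2 * (g x)\<^sup>2 \<partial>\<mu>) =
      (\<integral>x. (f x)\<^sup>2 \<partial>\<mu>) * (\<integral>x. (g x)\<^sup>2 \<partial>\<mu>) + 2 * (\<integral>x. f x * g x \<partial>\<mu>)\<^sup>2"
proof -
  have sets: "sets \<mu> = sets borel" and mean: "(\<integral>x. x \<partial>\<mu>) = 0"
    and normal: "\<And>h :: complex^'n \<Rightarrow> real. linear h \<Longrightarrow> normal_law (distr \<mu> borel h)"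
    using gauss by (auto simp: circ_complex_gaussian_def)
  have meas: "h \<in> borel_measurable \<mu>" if "linear h" for h :: "complex^'n \<Rightarrow> real"
  proof -
    have "h \<in> borel_measurable borel"
      using that by (intro borel_measurable_continuous_onI linear_continuous_on)
        (simp add: linear_conv_bounded_linear)
    then show ?thesis
      using measurable_cong_sets[OF sets refl] by blast
  qed
  have int: "integrable \<mu> h" if "linear h" for h :: "complex^'n \<Rightarrow> real"
    using integrable_normal_law_power[OF normal[OF that], of 1] meas[OF that]
    by (simp add: integrable_distr_eq)
  \<comment> \<open>The Bochner integral of a non-integrable function is 0 by default, so the mean
    condition says something about functionals only once integrability is known; then
    \<open>h\<close> commutes with the integral.\<close>
  have "integrable \<mu> (\<lambda>x. x)"
    by (rule integrable_euclideanI) (rule int, rule bounded_linear.linear[OF bounded_linear_inner_left])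
  then have zero: "(\<integral>x. h x \<partial>\<mu>) = 0" if "linear h" for h :: "complex^'n \<Rightarrow> real"
  proof -
    have "bounded_linear h"
      using that by (simp add: linear_conv_bounded_linear)
    from integral_bounded_linear[OF this \<open>integrable \<mu> (\<lambda>x. x)\<close>] show ?thesis
      unfolding mean linear_0[OF that] .
  qed
  \<comment> \<open>Combinations of \<open>f\<close> and \<open>g\<close> are again real-linear,
    which is exactly the joint normality that Isserlis' formula asks for.\<close>
  have joint: "normal_law (distr \<mu> borel (\<lambda>x. a * f x + b * g x))" for a b
    using lin by (intro normal) (simp add: linear_iff algebra_simps)
  note * = meas[OF lin(1)] meas[OF lin(2)] joint zero[OF lin(1)] zero[OF lin(2)]
  show "integrable \<mu> (\<lambda>x. f x * g x)"
    by (rule integrable_joint_normal_mult[OF *])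
  show "integrable \<mu> (\<lambda>x. (f x)\<^sup>2 * (g x)\<^sup>2)"
    by (rule integrable_joint_normal_sq_mult_sq[OF *])
  show "(\<integral>x. (f x)\<^sup>2 * (g x)\<^sup>2 \<partial>\<mu>) =
      (\<integral>x. (f x)\<^sup>2 \<partial>\<mu>) * (\<integral>x. (g x)\<^sup>2 \<partial>\<mu>) + 2 * (\<integral>x. f x * g x \<partial>\<mu>)\<^sup>2"
    by (rule integral_joint_normal_sq_mult_sq[OF *])
qed

lemma
  fixes S :: "complex^'n^'n"
  assumes gauss: "circ_complex_gaussian S \<mu>"
  shows circ_complex_gaussian_integrable_outer_H: "integrable \<mu> (\<lambda>x. outer_H x x)"
    and circ_complex_gaussian_integrable_norm_outer_H_sq:
      "integrable \<mu> (\<lambda>x. (norm (outer_H x x))\<^sup>2)"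
    and circ_complex_gaussian_norm_outer_H_sq:
      "(\<integral>x. (norm (outer_H x x))\<^sup>2 \<partial>\<mu>) = (Re (trace S))\<^sup>2 + (norm S)\<^sup>2"
proof -
  have lin: "linear (\<lambda>x :: complex^'n. Re (x $ i))" "linear (\<lambda>x :: complex^'n. Im (x $ i))" for i
    by (simp_all add: linear_iff)
  note moments = circ_complex_gaussian_linear[OF gauss]
  note int2 = moments(1)[OF lin(1) lin(1)] moments(1)[OF lin(1) lin(2)]
    moments(1)[OF lin(2) lin(1)] moments(1)[OF lin(2) lin(2)]
  note int4 = moments(2)[OF lin(1) lin(1)] moments(2)[OF lin(1) lin(2)]
    moments(2)[OF lin(2) lin(1)] moments(2)[OF lin(2) lin(2)]
  note isserlis = moments(3)[OF lin(1) lin(1)] moments(3)[OF lin(1) lin(2)]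
    moments(3)[OF lin(2) lin(1)] moments(3)[OF lin(2) lin(2)]
  have intC: "integrable \<mu> f" if "integrable \<mu> (\<lambda>x. Re (f x))" "integrable \<mu> (\<lambda>x. Im (f x))"
    for f :: "complex^'n \<Rightarrow> complex"
  proof (rule integrable_euclideanI)
    fix b :: complex assume "b \<in> Basis"
    then consider "b = 1" | "b = \<i>"
      by (auto simp: Basis_complex_def)
    then show "integrable \<mu> (\<lambda>x. f x \<bullet> b)"
      using that by cases (simp_all add: inner_complex_def)
  qed
  have iH: "integrable \<mu> (\<lambda>x. x $ i * cnj (x $ j))" and iT: "integrable \<mu> (\<lambda>x. x $ i * x $ j)" for i j
    using int2[of i j] by (auto intro!: intC)
  have outer: "integrable \<mu> (\<lambda>x. outer_H x x)" "integrable \<mu> (\<lambda>x. outer_T x x)"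
    by (intro integrable_vecI; simp add: outer_H_def outer_T_def iH iT)+
  then show "integrable \<mu> (\<lambda>x. outer_H x x)"
    by blast
  \<comment> \<open>A matrix is a vector of rows, so extracting an entry from its integral exchanges
    \<open>$\<close> with the integral twice, and each exchange needs its own integrability
    fact.\<close>
  have rows: "integrable \<mu> (\<lambda>x. outer_H x x $ i)" "integrable \<mu> (\<lambda>x. outer_T x x $ i)" for i
    using outer by (auto intro: integrable_bounded_linear[OF bounded_linear_vec_nth])
  have S_eq: "S $ i $ j = (\<integral>x. x $ i * cnj (x $ j) \<partial>\<mu>)" for i j
  proof -
    have "S = (\<integral>x. outer_H x x \<partial>\<mu>)"
      using gauss by (simp add: circ_complex_gaussian_def)
    then show ?thesis
      using integral_vec_nth[OF outer(1), of i] integral_vec_nth[OF rows(1), of i j]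
      by (simp add: outer_H_def)
  qed
  have T_eq: "(\<integral>x. x $ i * x $ j \<partial>\<mu>) = 0" for i j
  proof -
    have "(\<integral>x. outer_T x x \<partial>\<mu>) = 0"
      using gauss by (simp add: circ_complex_gaussian_def)
    then show ?thesis
      using integral_vec_nth[OF outer(2), of i] integral_vec_nth[OF rows(2), of i j]
      by (simp add: outer_T_def)
  qed
  define rr ri ir ii where "rr i j = (\<integral>x. Re (x $ i) * Re (x $ j) \<partial>\<mu>)"
    and "ri i j = (\<integral>x. Re (x $ i) * Im (x $ j) \<partial>\<mu>)"
    and "ir i j = (\<integral>x. Im (x $ i) * Re (x $ j) \<partial>\<mu>)"
    and "ii i j = (\<integral>x. Im (x $ i) * Im (x $ j) \<partial>\<mu>)" for i j
  note defs = rr_def ri_def ir_def ii_def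
  \<comment> \<open>Real and imaginary parts of x_i times the conjugate of x_j.\<close>
  have ReS: "Re (S $ i $ j) = rr i j + ii i j" and ImS: "Im (S $ i $ j) = ir i j - ri i j" for i j
    using int2[of i j] iH[of i j] unfolding S_eq defs
    by (simp_all flip: integral_Re integral_Im)
  \<comment> \<open>Circular symmetry, $E[x_i x_j] = 0$, turns the entries of $S$ into $2 (\mathtt{rr} + \mathrm{i}\,\mathtt{ir})$.\<close>
  have ReT: "rr i j = ii i j" and ImT: "ri i j = - ir i j" for i j
    using arg_cong[OF T_eq[of i j], of Re] arg_cong[OF T_eq[of i j], of Im]
      int2[of i j] iT[of i j] unfolding defs
    by (simp_all flip: integral_Re integral_Im)
  have fourth: "(norm (outer_H x x))\<^sup>2 = (\<Sum>i\<in>UNIV. \<Sum>j\<in>UNIV.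
      (Re (x $ i))\<^sup>2 * (Re (x $ j))\<^sup>2 + (Re (x $ i))\<^sup>2 * (Im (x $ j))\<^sup>2 +
      (Im (x $ i))\<^sup>2 * (Re (x $ j))\<^sup>2 + (Im (x $ i))\<^sup>2 * (Im (x $ j))\<^sup>2)" for x :: "complex^'n"
    unfolding norm_outer_H_sq
    by (simp add: power2_norm_eq_inner inner_vec_def inner_complex_def sum_product)
      (simp add: power2_eq_square algebra_simps)
  show "integrable \<mu> (\<lambda>x. (norm (outer_H x x))\<^sup>2)"
    unfolding fourth
    by (intro Bochner_Integration.integrable_sum Bochner_Integration.integrable_add int4)
  have "(\<integral>x. (norm (outer_H x x))\<^sup>2 \<partial>\<mu>) = (\<Sum>i\<in>UNIV. \<Sum>j\<in>UNIV.
      (rr i i * rr j j + 2 * (rr i j)\<^sup>2) + (rr i i * ii j j + 2 * (ri i j)\<^sup>2) +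
      (ii i i * rr j j + 2 * (ir i j)\<^sup>2) + (ii i i * ii j j + 2 * (ii i j)\<^sup>2))"
    unfolding fourth using int4
    by (simp add: isserlis) (simp add: defs power2_eq_square)
  \<comment> \<open>Since \<open>rr = ii\<close> and \<open>ri = - ir\<close>, the squares pair up:
    2 rr^2 + 2 ii^2 = (2 ii)^2 is the squared real part of S_ij and 2 ri^2 + 2 ir^2 = (2 ir)^2 its
    squared imaginary part. The remaining products factor as (rr_ii + ii_ii)(rr_jj + ii_jj).\<close>
  also have "\<dots> = (\<Sum>i\<in>UNIV. \<Sum>j\<in>UNIV.
      Re (S $ i $ i) * Re (S $ j $ j) + ((Re (S $ i $ j))\<^sup>2 + (Im (S $ i $ j))\<^sup>2))"
    unfolding ReS ImS ReT ImT by (simp add: power2_eq_square algebra_simps)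
  also have "\<dots> = (Re (trace S))\<^sup>2 + (norm S)\<^sup>2"
    by (simp add: sum.distrib sum_product trace_def power2_norm_eq_inner inner_vec_def
        inner_complex_def)
      (simp add: power2_eq_square sum_product)
  finally show "(\<integral>x. (norm (outer_H x x))\<^sup>2 \<partial>\<mu>) = (Re (trace S))\<^sup>2 + (norm S)\<^sup>2" .
qed

lemma borel_measurable_outer_H_diag[measurable]:
  "(\<lambda>x :: complex^'n. outer_H x x) \<in> borel_measurable borel"
  unfolding outer_H_def
  by (intro borel_measurable_continuous_onI continuous_on_vec_lambda continuous_on_mult
      continuous_on_component continuous_on_cnj continuous_on_id)

section \<open>Mean squared errors of the sample covariance\<close>

context
  fixes M :: "'w measure" and J :: "nat \<Rightarrow> 'w \<Rightarrow> complex^'p" and S :: "complex^'p^'p" and K :: nat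
  assumes M: "prob_space M" and K: "K \<ge> 1"
    and indep: "prob_space.indep_vars M (\<lambda>_. borel) J {..<K}"
    and gauss: "\<And>k. k < K \<Longrightarrow> circ_complex_gaussian S (distr M borel (J k))"
begin

interpretation prob_space M by (rule M)

lemma
  assumes k: "k < K"
  shows integrable_sample_error: "integrable M (\<lambda>\<omega>. outer_H (J k \<omega>) (J k \<omega>) - S)"
    and expectation_sample_error: "expectation (\<lambda>\<omega>. outer_H (J k \<omega>) (J k \<omega>) - S) = 0"
    and integrable_sample_error_sq: "integrable M (\<lambda>\<omega>. (norm (outer_H (J k \<omega>) (J k \<omega>) - S))\<^sup>2)"
    and expectation_sample_error_sq:
      "expectation (\<lambda>\<omega>. (norm (outer_H (J k \<omega>) (J k \<omega>) - S))\<^sup>2) = (Re (trace S))\<^sup>2"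
proof -
  have J[measurable]: "J k \<in> borel_measurable M"
    using indep k by (auto simp: indep_vars_def)
  note g = gauss[OF k]
  have int: "integrable M (\<lambda>\<omega>. outer_H (J k \<omega>) (J k \<omega>))"
    "integrable M (\<lambda>\<omega>. (norm (outer_H (J k \<omega>) (J k \<omega>)))\<^sup>2)"
    using circ_complex_gaussian_integrable_outer_H[OF g]
      circ_complex_gaussian_integrable_norm_outer_H_sq[OF g]
    by (simp_all add: integrable_distr_eq)
  have E: "expectation (\<lambda>\<omega>. outer_H (J k \<omega>) (J k \<omega>)) = S"
    using g by (simp add: circ_complex_gaussian_def integral_distr)
  have E2: "expectation (\<lambda>\<omega>. (norm (outer_H (J k \<omega>) (J k \<omega>)))\<^sup>2) = (Re (trace S))\<^sup>2 + (norm S)\<^sup>2"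
    using circ_complex_gaussian_norm_outer_H_sq[OF g] by (simp add: integral_distr)
  show "integrable M (\<lambda>\<omega>. outer_H (J k \<omega>) (J k \<omega>) - S)"
    using int by simp
  show "expectation (\<lambda>\<omega>. outer_H (J k \<omega>) (J k \<omega>) - S) = 0"
    using int E by (simp add: prob_space)
  show "integrable M (\<lambda>\<omega>. (norm (outer_H (J k \<omega>) (J k \<omega>) - S))\<^sup>2)"
    by (rule integrable_norm_diff_sq[OF int])
  show "expectation (\<lambda>\<omega>. (norm (outer_H (J k \<omega>) (J k \<omega>) - S))\<^sup>2) = (Re (trace S))\<^sup>2"
    \<comment> \<open>Centring at the mean S subtracts ||S||^2, which cancels that term of the
      fourth moment.\<close>
    unfolding expectation_norm_diff_sq[OF int] E E2 by (simp add: power2_norm_eq_inner)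
qed

text \<open>Exhibits the error as an average of centred independent terms; K >= 1 allows S to be
  written as the average of K copies of itself.\<close>

lemma sample_cov_diff:
  "sample_cov K J \<omega> - S = (1 / real K) *\<^sub>R (\<Sum>k<K. outer_H (J k \<omega>) (J k \<omega>) - S)"
  using K by (simp add: sample_cov_def sum_subtractf scaleR_diff_right sum_constant_scaleR
      del: sum_constant)

lemma
  shows integrable_sample_cov_error_sq: "integrable M (\<lambda>\<omega>. (norm (sample_cov K J \<omega> - S))\<^sup>2)"
    and beta_sq_eq: "beta_sq M K J S = (Re (trace S))\<^sup>2 / K"
proof -
  have ind: "indep_vars (\<lambda>_. borel) (\<lambda>k \<omega>. outer_H (J k \<omega>) (J k \<omega>) - S) {..<K}"
    by (rule indep_vars_compose2[OF indep, of "\<lambda>_ x. outer_H x x - S"]) measurable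
  have eq: "(norm (sample_cov K J \<omega> - S))\<^sup>2 =
      (norm (\<Sum>k<K. outer_H (J k \<omega>) (J k \<omega>) - S))\<^sup>2 / (real K)\<^sup>2" for \<omega>
    unfolding sample_cov_diff by (simp add: power_divide)
  note * = finite_lessThan ind integrable_sample_error integrable_sample_error_sq
    expectation_sample_error
  show "integrable M (\<lambda>\<omega>. (norm (sample_cov K J \<omega> - S))\<^sup>2)"
    unfolding eq by (intro integrable_divide_zero integrable_norm_sum_sq_indep *) auto
  have "expectation (\<lambda>\<omega>. (norm (\<Sum>k<K. outer_H (J k \<omega>) (J k \<omega>) - S))\<^sup>2) =
      (\<Sum>k<K. expectation (\<lambda>\<omega>. (norm (outer_H (J k \<omega>) (J k \<omega>) - S))\<^sup>2))"
    by (intro expectation_norm_sum_sq_indep *) auto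
  also have "\<dots> = K * (Re (trace S))\<^sup>2"
    by (simp add: expectation_sample_error_sq)
  \<comment> \<open>The K equal variances meet the factor 1 / K^2 from \<open>eq\<close>, leaving 1
    / K.\<close>
  finally show "beta_sq M K J S = (Re (trace S))\<^sup>2 / K"
    unfolding beta_sq_def frobenius_norm_eq_norm eq by (simp add: power2_eq_square)
qed

lemma delta_sq_eq:
  "delta_sq M K J S = beta_sq M K J S + (norm S)\<^sup>2 - (norm (trace S))\<^sup>2 / CARD('p)"
proof -
  have int: "integrable M (\<lambda>\<omega>. sample_cov K J \<omega> - S)"
    unfolding sample_cov_diff
    by (intro integrable_scaleR_right Bochner_Integration.integrable_sum integrable_sample_error) auto
  have mean: "expectation (\<lambda>\<omega>. sample_cov K J \<omega> - S) = 0"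
    unfolding sample_cov_diff
    \<comment> \<open>The deleted rules would split each difference, and
      \<open>expectation_sample_error\<close> would no longer match.\<close>
    by (simp add: Bochner_Integration.integral_sum integrable_sample_error expectation_sample_error
        del: Bochner_Integration.integral_diff sum_subtractf)
  \<comment> \<open>Recentring at S: the random part is now centred and
    \<open>target_mat S - S\<close> is a constant, so no cross term remains.\<close>
  have "delta_sq M K J S =
      expectation (\<lambda>\<omega>. (norm (sample_cov K J \<omega> - S - (target_mat S - S)))\<^sup>2)"
    unfolding delta_sq_def frobenius_norm_eq_norm by simp
  also have "\<dots> = beta_sq M K J S + (norm (S - target_mat S))\<^sup>2"
    unfolding expectation_norm_diff_sq[OF int integrable_sample_cov_error_sq] mean
    by (simp add: beta_sq_def frobenius_norm_eq_norm norm_minus_commute)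
  finally show ?thesis
    by (simp add: norm_diff_target_mat_sq)
qed

end

section \<open>The formula for the ratio\<close>

theorem theorem2:
  fixes M :: "'w measure"
    and J :: "nat \<Rightarrow> 'w \<Rightarrow> complex^'p"
    and S :: "complex^'p^'p"
    and K :: nat
  assumes "prob_space M"
    and "K \<ge> 1"
    and "hermitian_psd S"
    and "prob_space.indep_vars M (\<lambda>_. borel) J {..<K}"
    and "\<And>k. k < K \<Longrightarrow> circ_complex_gaussian S (distr M borel (J k))"
    and "delta_sq M K J S \<noteq> 0"
  shows "complex_of_real (beta_sq M K J S / delta_sq M K J S) =
    (trace S)\<^sup>2 /
      ((1 - of_nat K / of_nat CARD('p)) * (trace S)\<^sup>2 + of_nat K * trace (S ** S))"
proof -
  define t where "t = Re (trace S)"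
  have herm: "conj_transpose S = S"
    using assms(3) by (simp add: hermitian_psd_def)
  have tr: "trace S = of_real t"
    unfolding t_def by (rule hermitian_trace_real[OF herm])
  \<comment> \<open>For Hermitian S the product \<open>S ** S\<close> is S S^H, whose trace is the
    squared Frobenius norm.\<close>
  have tr2: "trace (S ** S) = of_real ((norm S)\<^sup>2)"
    using trace_mult_conj_transpose[of S] by (simp add: herm)
  have beta: "beta_sq M K J S = t\<^sup>2 / K"
    unfolding t_def by (rule beta_sq_eq[OF assms(1,2,4,5)])
  have "delta_sq M K J S = t\<^sup>2 / K + (norm S)\<^sup>2 - t\<^sup>2 / CARD('p)"
    using delta_sq_eq[OF assms(1,2,4,5)] by (simp add: beta tr)
  \<comment> \<open>Scaling by K turns delta^2 into the stated denominator, while K beta^2 = t^2 is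
    the numerator.\<close>
  then have delta: "K * delta_sq M K J S = (1 - K / CARD('p)) * t\<^sup>2 + K * (norm S)\<^sup>2"
    using assms(2) by (simp add: field_simps)
  have "beta_sq M K J S / delta_sq M K J S = t\<^sup>2 / (K * delta_sq M K J S)"
    by (simp add: beta)
  then show ?thesis
    unfolding delta tr tr2 by simp
qed

end
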